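(* Let $\mathcal{G}=(\mathcal{V},\mathcal{E})$ be a connected graph with $\mathcal{V}=\{1,\ldots,n\}$, and let $\{G_{ij}\}_{(i,j)\in\mathcal{E}}$ be a collection of matrices in $GL(d,\mathbb{R})$. Let $\{G_i\}_{i\in\mathcal{V}}$ be a collection of matrices in $GL(d,\mathbb{R})$ obtained from Algorithm 2 (defined in the context), and let $\{G_i^*\}_{i\in\mathcal{V}}$ be a collection of matrices solving the optimization problem $$\min_{\{R_i\}_{i\in\mathcal{V}}}\ \sum_{(i,j)\in\mathcal{E}}\tfrac12\|G_{ij}-R_i^{-1}R_j\|_F^2\quad\text{s.t. } R_i\in O(d)\text{ for all }i\in\mathcal{V}.$$ Then $$f(\{\sqrt{n}\,G_i^{-1}\}_{i\in\mathcal{V}})\le g(\{G_i^*\}_{i\in\mathcal{V}}).$$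
   Context: $\mathcal{G}=(\mathcal{V},\mathcal{E})$ is a directed graph with node set $\mathcal{V}=\{1,\ldots,n\}$ and edge set $\mathcal{E}\subset\mathcal{V}\times\mathcal{V}$. The graph is connected if there is an undirected path from any node to any other node, i.e. a finite sequence of unique nodes such that for any pair $(i,j)$ of consecutive nodes, $(i,j)\in\mathcal{E}$ or $(j,i)\in\mathcal{E}$. $O(d)=\{R\in\mathbb{R}^{d\times d}:R^TR=I\}$ and $\|\cdot\|_F$ is the Frobenius norm. The functions $f$ and $g$ (depending on the given $\{G_{ij}\}_{(i,j)\in\mathcal{E}}$) are $$f(\{X_i\}_{i\in\mathcal{V}})=\sum_{(i,j)\in\mathcal{E}}\tfrac12\|G_{ij}X_j-X_i\|_F^2,\qquad g(\{R_i\}_{i\in\mathcal{V}})=\sum_{(i,j)\in\mathcal{E}}\tfrac12\|G_{ij}-R_i^{-1}R_j\|_F^2,$$ so that $f(\{\sqrt n\,G_i^{-1}\})=\sum_{(i,j)\in\mathcal{E}}\frac12\|\sqrt n\,G_{ij}G_j^{-1}-\sqrt n\,G_i^{-1}\|_F^2$. The matrix $H$: let $A$ be the adjacency matrix ($A_{ij}=1$ if $(i,j)\in\mathcal{E}$, $0$ otherwise). Let $W(\mathcal{G},\{G_{ij}\})\in\mathbb{R}^{nd\times nd}$ be the block matrix whose $(i,j)$ block of size $d\times d$ is $G_{ij}$ if $(i,j)\in\mathcal{E}$ and $0$ otherwise, and let $Z(\mathcal{G},\{G_{ij}\})=\mathrm{diag}(A\,1_n)\otimes I_d-W(\mathcal{G},\{G_{ij}\})$,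 with $1_n$ the all-ones vector. Let $\bar{\mathcal{G}}=(\mathcal{V},\bar{\mathcal{E}})$ be $\mathcal{G}$ with all edges reversed and $\bar G_{ij}=G_{ji}^T$ for $(i,j)\in\bar{\mathcal{E}}$. Put $\bar W=W(\bar{\mathcal{G}},\{\bar G_{ij}\}_{(i,j)\in\bar{\mathcal{E}}})$ and $Z_2=\mathrm{diag}(\bar W\bar W^T)-\bar W$, where here $\mathrm{diag}(B)$ keeps the $d\times d$ diagonal blocks of $B\in\mathbb{R}^{nd\times nd}$ and sets all other blocks to zero. Then $H=Z(\mathcal{G},\{G_{ij}\})+Z_2$. Algorithm 2: let $V_1\in\mathbb{R}^{nd\times d}$ be an optimal solution of $\min_{W}\mathrm{trace}(W^THW)$ subject to $W\in\mathbb{R}^{nd\times d}$, $W^TW=I$; its output is the collection $\{G_i\}_{i\in\mathcal{V}}$ in $GL(d,\mathbb{R})$ determined by $V_1^T=[G_1^{-T},G_2^{-T},\ldots,G_n^{-T}]$, i.e. the $i$th $d\times d$ block of $V_1$ (which must be invertible for the algorithm to be executable) equals $G_i^{-1}$. *)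

theory Defs
  imports "HOL-Analysis.Analysis"
begin

text \<open>
  The finite type \<open>'n\<close> is the node set \<open>{1, \<dots>, n}\<close>, so \<open>n = CARD('n)\<close>, and \<open>d = CARD('d)\<close>.
  An \<open>nd \<times> nd\<close> matrix is indexed by pairs: the entry at \<open>((i, a), (j, b))\<close> is entry \<open>(a, b)\<close> of
  its block \<open>(i, j)\<close>. In a family \<open>G :: 'n \<Rightarrow> 'n \<Rightarrow> real^'d^'d\<close> only the values at edges matter.
\<close>

definition graph_connected :: "('n \<times> 'n) set \<Rightarrow> bool" where
  "graph_connected E \<longleftrightarrow>
    (\<forall>i j. i \<noteq> j \<longrightarrow>
      (\<exists>p. p \<noteq> [] \<and> hd p = i \<and> last p = j \<and> distinct p \<and>
           successively (\<lambda>u v. (u, v) \<in> E \<or> (v, u) \<in> E) p))"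

definition GL :: "(real^'d^'d) set" where
  "GL = {M. invertible M}"

text \<open>The library norm on matrices is the Frobenius norm.\<close>

lemma norm_eq_frobenius:
  fixes M :: "real^'a^'b"
  shows "norm M = sqrt (\<Sum>i\<in>UNIV. \<Sum>j\<in>UNIV. (M $ i $ j)\<^sup>2)"
  by (simp add: norm_vec_def L2_set_def sum_nonneg)

definition f_cost ::
  "('n::finite \<times> 'n) set \<Rightarrow> ('n \<Rightarrow> 'n \<Rightarrow> real^'d^'d) \<Rightarrow> ('n \<Rightarrow> real^'d^'d) \<Rightarrow> real" where
  "f_cost E G X = (\<Sum>(i, j)\<in>E. 1/2 * (norm (G i j ** X j - X i))\<^sup>2)"

definition g_cost ::
  "('n::finite \<times> 'n) set \<Rightarrow> ('n \<Rightarrow> 'n \<Rightarrow> real^'d^'d) \<Rightarrow> ('n \<Rightarrow> real^'d^'d) \<Rightarrow> real" where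
  "g_cost E G R = (\<Sum>(i, j)\<in>E. 1/2 * (norm (G i j - matrix_inv (R i) ** R j))\<^sup>2)"

definition adjacency :: "('n::finite \<times> 'n) set \<Rightarrow> real^'n^'n" where
  "adjacency E = (\<chi> i j. if (i, j) \<in> E then 1 else 0)"

definition diag_vec :: "real^'n \<Rightarrow> real^'n^'n" where
  "diag_vec v = (\<chi> i j. if i = j then v $ i else 0)"

definition kronecker :: "real^'a^'b \<Rightarrow> real^'c^'e \<Rightarrow> real^('a \<times> 'c)^('b \<times> 'e)" where
  "kronecker A B = (\<chi> p q. A $ fst p $ fst q * B $ snd p $ snd q)"

definition W_mat ::
  "('n::finite \<times> 'n) set \<Rightarrow> ('n \<Rightarrow> 'n \<Rightarrow> real^'d^'d) \<Rightarrow> real^('n \<times> 'd)^('n \<times> 'd)" where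
  "W_mat E G =
    (\<chi> p q. if (fst p, fst q) \<in> E then G (fst p) (fst q) $ snd p $ snd q else 0)"

definition Z_mat ::
  "('n::finite \<times> 'n) set \<Rightarrow> ('n \<Rightarrow> 'n \<Rightarrow> real^'d^'d) \<Rightarrow> real^('n \<times> 'd)^('n \<times> 'd)" where
  "Z_mat E G = kronecker (diag_vec (adjacency E *v 1)) (mat 1 :: real^'d^'d) - W_mat E G"

definition block_diag ::
  "real^('n::finite \<times> 'd::finite)^('n \<times> 'd) \<Rightarrow> real^('n \<times> 'd)^('n \<times> 'd)" where
  "block_diag B = (\<chi> p q. if fst p = fst q then B $ p $ q else 0)"

definition W_bar ::
  "('n::finite \<times> 'n) set \<Rightarrow> ('n \<Rightarrow> 'n \<Rightarrow> real^'d^'d) \<Rightarrow> real^('n \<times> 'd)^('n \<times> 'd)" where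
  "W_bar E G = W_mat (E\<inverse>) (\<lambda>i j. transpose (G j i))"

definition Z2_mat ::
  "('n::finite \<times> 'n) set \<Rightarrow> ('n \<Rightarrow> 'n \<Rightarrow> real^'d^'d) \<Rightarrow> real^('n \<times> 'd)^('n \<times> 'd)" where
  "Z2_mat E G = block_diag (W_bar E G ** transpose (W_bar E G)) - W_bar E G"

definition H_mat ::
  "('n::finite \<times> 'n) set \<Rightarrow> ('n \<Rightarrow> 'n \<Rightarrow> real^'d^'d) \<Rightarrow> real^('n \<times> 'd)^('n \<times> 'd)" where
  "H_mat E G = Z_mat E G + Z2_mat E G"

text \<open>The \<open>d \<times> nd\<close> matrix \<open>[B\<^sub>1, \<dots>, B\<^sub>n]\<close>.\<close>

definition block_row :: "('n::finite \<Rightarrow> real^'d^'d) \<Rightarrow> real^('n \<times> 'd)^'d" where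
  "block_row B = (\<chi> a q. B (fst q) $ a $ snd q)"

text \<open>The minimisation problem need not have a unique solution, so the output is a relation.\<close>

definition algorithm2_output ::
  "('n::finite \<times> 'n) set \<Rightarrow> ('n \<Rightarrow> 'n \<Rightarrow> real^'d^'d) \<Rightarrow> ('n \<Rightarrow> real^'d^'d) \<Rightarrow> bool" where
  "algorithm2_output E G Gs \<longleftrightarrow>
    (\<exists>V1 :: real^'d^('n \<times> 'd).
      is_arg_min (\<lambda>W. trace (transpose W ** H_mat E G ** W))
                 (\<lambda>W. transpose W ** W = mat 1) V1 \<and>
      (\<forall>i. Gs i \<in> GL) \<and>
      transpose V1 = block_row (\<lambda>i. transpose (matrix_inv (Gs i))))"

end

theory Submission
  imports Defs
begin

text \<open>
  Stack a family \<open>X\<close> of \<open>d \<times> d\<close> blocks into an \<open>nd \<times> d\<close> matrix \<open>V\<close>. Expanding the squares in \<open>f\<close>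
  shows that \<open>trace (V\<^sup>T H V) = 2 f(X)\<close>: the degrees in \<open>H\<close> produce the terms \<open>\<parallel>X\<^sub>i\<parallel>\<^sup>2\<close>, the block diagonal of
  \<open>Z\<^sub>2\<close> produces the terms \<open>\<parallel>G\<^sub>i\<^sub>j X\<^sub>j\<parallel>\<^sup>2\<close>, and the two off-diagonal parts each produce the mixed term
  once (\<open>trace_H_mat\<close>). So the output of the algorithm minimises \<open>f\<close> over
  all stacks with \<open>V\<^sup>T V = I\<close>, a spectral relaxation of the orthogonal problem.

  For orthogonal \<open>R\<^sub>i\<close>, the stack of the blocks \<open>R\<^sub>i\<^sup>T / \<surd>n\<close> satisfies this constraint, because
  \<open>\<Sum>\<^sub>i R\<^sub>i R\<^sub>i\<^sup>T = n I\<close>. As \<open>f\<close> is homogeneous of degree two, the factor \<open>\<surd>n\<close> in the claim cancels the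
  normalisation, which leaves \<open>f({R\<^sub>i\<^sup>T}) = g({R\<^sub>i})\<close>. This last equation holds since
  right multiplication by \<open>R\<^sub>j\<close> preserves the Frobenius norm and takes \<open>G\<^sub>i\<^sub>j R\<^sub>j\<^sup>T - R\<^sub>i\<^sup>T\<close> to
  \<open>G\<^sub>i\<^sub>j - R\<^sub>i\<^sup>-\<^sup>1 R\<^sub>j\<close>.
\<close>

lemma inner_matrix_mult_left:
  fixes A :: "real^'m^'l" and B :: "real^'k^'m" and C :: "real^'k^'l"
  shows "(A ** B) \<bullet> C = B \<bullet> (transpose A ** C)"
proof -
  have "(A ** B) \<bullet> C = (\<Sum>i\<in>UNIV. \<Sum>j\<in>UNIV. \<Sum>k\<in>UNIV. A$i$k * B$k$j * C$i$j)"
    by (simp add: inner_vec_def matrix_matrix_mult_def sum_distrib_right)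
  also have "\<dots> = (\<Sum>j\<in>UNIV. \<Sum>k\<in>UNIV. \<Sum>i\<in>UNIV. A$i$k * B$k$j * C$i$j)"
    by (subst sum.swap, rule sum.cong[OF refl], rule sum.swap)
  also have "\<dots> = (\<Sum>k\<in>UNIV. \<Sum>j\<in>UNIV. \<Sum>i\<in>UNIV. A$i$k * B$k$j * C$i$j)"
    by (rule sum.swap)
  also have "\<dots> = B \<bullet> (transpose A ** C)"
    by (simp add: inner_vec_def matrix_matrix_mult_def transpose_def sum_distrib_left ac_simps)
  finally show ?thesis .
qed

lemma inner_transpose:
  fixes A B :: "real^'k^'l"
  shows "transpose A \<bullet> transpose B = A \<bullet> B"
  by (simp add: inner_vec_def transpose_def) (rule sum.swap)

lemma norm_mult_orthogonal_right:
  fixes A :: "real^'k^'l" and Q :: "real^'k^'k"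
  assumes "orthogonal_matrix Q"
  shows "norm (A ** Q) = norm A"
proof -
  have "(A ** Q) \<bullet> (A ** Q) = (transpose Q ** transpose A) \<bullet> (transpose Q ** transpose A)"
    by (metis inner_transpose matrix_transpose_mul)
  also have "\<dots> = transpose A \<bullet> transpose A"
    using assms
    by (simp add: inner_matrix_mult_left matrix_mul_assoc orthogonal_matrix_def)
  finally show ?thesis
    by (simp add: inner_transpose norm_eq_sqrt_inner)
qed

lemma matrix_inv_orthogonal:
  fixes Q :: "real^'k^'k"
  assumes "orthogonal_matrix Q"
  shows "matrix_inv Q = transpose Q"
proof -
  have "Q ** matrix_inv Q = mat 1"
    unfolding matrix_inv_def
    by (rule someI2[of _ "transpose Q"]) (use assms in \<open>auto simp: orthogonal_matrix_def\<close>)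
  then have "transpose Q ** Q ** matrix_inv Q = transpose Q"
    by (simp flip: matrix_mul_assoc)
  then show ?thesis
    using assms by (simp add: orthogonal_matrix_def)
qed

definition block_col :: "('n::finite \<Rightarrow> real^'d^'d) \<Rightarrow> real^'d^('n \<times> 'd)" where
  "block_col X = (\<chi> p b. X (fst p) $ snd p $ b)"

definition block :: "real^('n::finite \<times> 'd::finite)^('n \<times> 'd) \<Rightarrow> 'n \<Rightarrow> 'n \<Rightarrow> real^'d^'d" where
  "block M i j = (\<chi> a b. M $ (i, a) $ (j, b))"

lemma sum_UNIV_prod:
  fixes h :: "'n::finite \<times> 'd::finite \<Rightarrow> 'a::comm_monoid_add"
  shows "(\<Sum>p\<in>UNIV. h p) = (\<Sum>i\<in>UNIV. \<Sum>a\<in>UNIV. h (i, a))"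
  by (simp add: sum.cartesian_product flip: UNIV_Times_UNIV)

lemma sum_edges:
  fixes h :: "'n::finite \<Rightarrow> 'n \<Rightarrow> 'a::comm_monoid_add"
  shows "(\<Sum>(i, j)\<in>E. h i j) = (\<Sum>i\<in>UNIV. \<Sum>j\<in>UNIV. if (i, j) \<in> E then h i j else 0)"
proof -
  have "(\<Sum>(i, j)\<in>E. h i j) = (\<Sum>p\<in>UNIV. if p \<in> E then h (fst p) (snd p) else 0)"
    by (simp add: sum.If_cases case_prod_beta)
  then show ?thesis
    by (simp add: sum_UNIV_prod cong: if_cong)
qed

lemma trace_transpose_mult:
  fixes A B :: "real^'k^'l"
  shows "trace (transpose A ** B) = A \<bullet> B"
  by (simp add: trace_def matrix_matrix_mult_def transpose_def inner_vec_def) (rule sum.swap)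

lemma trace_block_col:
  fixes M :: "real^('n::finite \<times> 'd::finite)^('n \<times> 'd)"
  shows "trace (transpose (block_col X) ** M ** block_col X)
    = (\<Sum>i\<in>UNIV. \<Sum>j\<in>UNIV. X i \<bullet> (block M i j ** X j))"
proof -
  let ?V = "block_col X"
  have entry: "(M ** ?V) $ (i, a) = (\<Sum>j\<in>UNIV. (block M i j ** X j) $ a)" for i a
    by (simp add: vec_eq_iff matrix_matrix_mult_def block_col_def block_def sum_UNIV_prod)
  have "trace (transpose ?V ** M ** ?V) = trace (transpose ?V ** (M ** ?V))"
    by (simp add: matrix_mul_assoc)
  also have "\<dots> = ?V \<bullet> (M ** ?V)"
    by (rule trace_transpose_mult)
  also have "\<dots> = (\<Sum>i\<in>UNIV. \<Sum>a\<in>UNIV. X i $ a \<bullet> (\<Sum>j\<in>UNIV. (block M i j ** X j) $ a))"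
    by (simp add: inner_vec_def[of ?V] sum_UNIV_prod entry)
       (simp add: block_col_def inner_vec_def)
  also have "\<dots> = (\<Sum>i\<in>UNIV. X i \<bullet> (\<Sum>j\<in>UNIV. block M i j ** X j))"
    by (simp add: inner_vec_def[of "X _"])
  finally show ?thesis
    by (simp add: inner_sum_right)
qed

lemma block_col_gram:
  "transpose (block_col X) ** block_col X = (\<Sum>i\<in>UNIV. transpose (X i) ** X i)"
  by (simp add: vec_eq_iff matrix_matrix_mult_def transpose_def block_col_def sum_UNIV_prod)

text \<open>
  The degree part of \<open>H\<close> counts edges leaving \<open>i\<close>, but the Gram part runs over edges entering
  \<open>i\<close>: row \<open>i\<close> of the reversed weight matrix has block \<open>G\<^sub>k\<^sub>i\<^sup>T\<close> exactly when \<open>(k, i)\<close> is an edge.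
\<close>

lemma block_H_mat:
  "block (H_mat E G) i j =
    (if i = j then (\<Sum>k\<in>UNIV. if (i, k) \<in> E then mat 1 else 0)
       + (\<Sum>k\<in>UNIV. if (k, i) \<in> E then transpose (G k i) ** G k i else 0) else 0)
    - (if (i, j) \<in> E then G i j else 0) - (if (j, i) \<in> E then transpose (G j i) else 0)"
proof -
  have deg: "(\<Sum>k\<in>UNIV. (if (i, k) \<in> E then 1 else 0::real)) * (mat 1 :: real^'d^'d) $ a $ b
      = (\<Sum>k\<in>UNIV. (if (i, k) \<in> E then mat 1 else 0 :: real^'d^'d) $ a $ b)" for i a b
    by (auto simp: sum_distrib_right intro!: sum.cong)
  have gram: "(\<Sum>k\<in>UNIV. \<Sum>c\<in>UNIV. (if (k, i) \<in> E then G k i $ c $ a else 0) *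
        (if (k, i) \<in> E then G k i $ c $ b else 0))
      = (\<Sum>k\<in>UNIV. (if (k, i) \<in> E then transpose (G k i) ** G k i else 0) $ a $ b)" for i a b
    by (auto simp: matrix_matrix_mult_def transpose_def intro!: sum.cong)
  show ?thesis
    unfolding H_mat_def Z_mat_def Z2_mat_def W_bar_def matrix_matrix_mult_def[of "W_mat _ _"]
    by (simp add: vec_eq_iff block_def W_mat_def kronecker_def diag_vec_def block_diag_def
        adjacency_def matrix_vector_mult_def transpose_def sum_UNIV_prod cong: if_cong)
       (auto simp: deg gram[unfolded transpose_def])
qed

text \<open>
  For an edge \<open>(i, j)\<close>, the square \<open>\<parallel>G\<^sub>i\<^sub>j X\<^sub>j - X\<^sub>i\<parallel>\<^sup>2\<close> is \<open>\<parallel>X\<^sub>i\<parallel>\<^sup>2 + \<parallel>G\<^sub>i\<^sub>j X\<^sub>j\<parallel>\<^sup>2\<close> minus twice the mixed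
  term. One copy of the mixed term comes from block \<open>(i, j)\<close> of \<open>H\<close>, the other from block
  \<open>(j, i)\<close>; the squares sit in the diagonal blocks \<open>i\<close> and \<open>j\<close>.
\<close>

lemma trace_H_mat:
  fixes X :: "'n::finite \<Rightarrow> real^'d^'d"
  shows "trace (transpose (block_col X) ** H_mat E G ** block_col X) = 2 * f_cost E G X"
proof -
  let ?out = "\<lambda>i. \<Sum>k\<in>UNIV. if (i, k) \<in> E then X i \<bullet> X i else 0"
  let ?in = "\<lambda>i. \<Sum>k\<in>UNIV. if (k, i) \<in> E then (G k i ** X i) \<bullet> (G k i ** X i) else 0"
  let ?m1 = "\<lambda>i j. if (i, j) \<in> E then X i \<bullet> (G i j ** X j) else 0"
  let ?m2 = "\<lambda>i j. if (j, i) \<in> E then X j \<bullet> (G j i ** X i) else 0"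
  have sum_mult: "(\<Sum>k\<in>UNIV. F k) ** A = (\<Sum>k\<in>UNIV. F k ** A)"
    for F :: "'n \<Rightarrow> real^'d^'d" and A :: "real^'d^'d"
    by (simp add: vec_eq_iff matrix_matrix_mult_def sum_distrib_right) (intro allI sum.swap)
  have add_mult: "(A + B) ** C = A ** C + B ** C" for A B C :: "real^'d^'d"
    by (simp add: vec_eq_iff matrix_matrix_mult_def distrib_right sum.distrib)
  have diff_mult: "(A - B) ** C = A ** C - B ** C" for A B C :: "real^'d^'d"
    by (simp add: vec_eq_iff matrix_matrix_mult_def left_diff_distrib sum_subtractf)
  have diag1: "X i \<bullet> ((\<Sum>k\<in>UNIV. if (i, k) \<in> E then mat 1 else 0) ** X i) = ?out i" for i
    by (auto simp: sum_mult inner_sum_right intro!: sum.cong)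
  have diag2: "X i \<bullet> ((\<Sum>k\<in>UNIV. if (k, i) \<in> E then transpose (G k i) ** G k i else 0) ** X i)
      = ?in i" for i
    by (auto simp: sum_mult inner_sum_right inner_matrix_mult_left matrix_mul_assoc
        intro!: sum.cong)
  have adjoint: "X i \<bullet> (transpose A ** X j) = X j \<bullet> (A ** X i)" for A i j
    by (metis inner_commute inner_matrix_mult_left)
  have entry: "X i \<bullet> (block (H_mat E G) i j ** X j)
      = (if i = j then ?out i + ?in i else 0) - ?m1 i j - ?m2 i j" for i j
    by (auto simp: block_H_mat diff_mult add_mult inner_diff_right inner_add_right
        diag1 diag2 adjoint)
  have "trace (transpose (block_col X) ** H_mat E G ** block_col X)
      = (\<Sum>i\<in>UNIV. ?out i) + (\<Sum>i\<in>UNIV. ?in i)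
        - (\<Sum>i\<in>UNIV. \<Sum>j\<in>UNIV. ?m1 i j) - (\<Sum>i\<in>UNIV. \<Sum>j\<in>UNIV. ?m2 i j)"
    unfolding trace_block_col entry by (simp add: sum_subtractf sum.distrib)
  also have "(\<Sum>i\<in>UNIV. ?in i) = (\<Sum>i\<in>UNIV. \<Sum>j\<in>UNIV.
      if (i, j) \<in> E then (G i j ** X j) \<bullet> (G i j ** X j) else 0)"
    by (rule sum.swap)
  also have "(\<Sum>i\<in>UNIV. \<Sum>j\<in>UNIV. ?m2 i j) = (\<Sum>i\<in>UNIV. \<Sum>j\<in>UNIV. ?m1 i j)"
    by (rule sum.swap)
  also have "(\<Sum>i\<in>UNIV. ?out i) + (\<Sum>i\<in>UNIV. \<Sum>j\<in>UNIV.
        if (i, j) \<in> E then (G i j ** X j) \<bullet> (G i j ** X j) else 0)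
      - (\<Sum>i\<in>UNIV. \<Sum>j\<in>UNIV. ?m1 i j) - (\<Sum>i\<in>UNIV. \<Sum>j\<in>UNIV. ?m1 i j)
      = (\<Sum>i\<in>UNIV. \<Sum>j\<in>UNIV. if (i, j) \<in> E then (norm (G i j ** X j - X i))\<^sup>2 else 0)"
    unfolding sum.distrib[symmetric] sum_subtractf[symmetric]
    by (intro sum.cong refl)
       (auto simp: power2_norm_eq_inner inner_diff_left inner_diff_right inner_commute)
  also have "\<dots> = 2 * f_cost E G X"
    unfolding f_cost_def sum_edges[symmetric] sum_distrib_left by (intro sum.cong) auto
  finally show ?thesis .
qed

lemma f_cost_scaleR: "f_cost E G (\<lambda>i. c *\<^sub>R X i) = c\<^sup>2 * f_cost E G X"
proof -
  have "G i j ** (c *\<^sub>R X j) - c *\<^sub>R X i = c *\<^sub>R (G i j ** X j - X i)" for i j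
    by (simp add: vec_eq_iff matrix_matrix_mult_def sum_distrib_left algebra_simps)
  then show ?thesis
    by (auto simp: f_cost_def sum_distrib_left power_mult_distrib intro!: sum.cong)
qed

lemma f_cost_transpose_orthogonal:
  assumes "\<And>i. orthogonal_matrix (R i)"
  shows "f_cost E G (\<lambda>i. transpose (R i)) = g_cost E G R"
proof -
  have "norm (G i j ** transpose (R j) - transpose (R i))
      = norm (G i j - matrix_inv (R i) ** R j)" for i j
  proof -
    have "(G i j ** transpose (R j) - transpose (R i)) ** R j
        = G i j ** (transpose (R j) ** R j) - transpose (R i) ** R j"
      by (simp add: vec_eq_iff matrix_mul_assoc)
         (simp add: matrix_matrix_mult_def left_diff_distrib sum_subtractf)
    then show ?thesis
      using assms norm_mult_orthogonal_right[of "R j"]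
      by (metis matrix_inv_orthogonal matrix_mul_rid orthogonal_matrix)
  qed
  then show ?thesis
    by (simp add: f_cost_def g_cost_def)
qed

lemma block_col_feasible:
  fixes R :: "'n::finite \<Rightarrow> real^'d^'d"
  assumes "\<And>i. orthogonal_matrix (R i)"
  defines "V \<equiv> block_col (\<lambda>i. (1 / sqrt (real CARD('n))) *\<^sub>R transpose (R i))"
  shows "transpose V ** V = mat 1"
proof -
  have "transpose (c *\<^sub>R transpose (R i)) ** (c *\<^sub>R transpose (R i)) = c\<^sup>2 *\<^sub>R mat 1" for c i
  proof -
    have "transpose (c *\<^sub>R transpose (R i)) ** (c *\<^sub>R transpose (R i))
        = c\<^sup>2 *\<^sub>R (R i ** transpose (R i))"
      by (simp add: vec_eq_iff matrix_matrix_mult_def transpose_def sum_distrib_left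
          power2_eq_square ac_simps)
    then show ?thesis
      using assms(1) by (simp add: orthogonal_matrix_def)
  qed
  then show ?thesis
    unfolding V_def block_col_gram by (simp add: sum_constant_scaleR power_divide del: sum_constant)
qed

text \<open>
  The factor \<open>\<surd>n\<close> is where the two normalisations meet: the algorithm compares stacks with
  \<open>V\<^sup>T V = I\<close>, whereas the stack of an orthogonal family has Gram matrix \<open>n I\<close>.
\<close>

lemma f_cost_algorithm2_le:
  fixes R :: "'n::finite \<Rightarrow> real^'d^'d"
  assumes "algorithm2_output E G Gs" and R: "\<And>i. orthogonal_matrix (R i)"
  shows "f_cost E G (\<lambda>i. sqrt (real CARD('n)) *\<^sub>R matrix_inv (Gs i)) \<le> g_cost E G R"
proof -
  let ?n = "real CARD('n)"
  let ?X = "\<lambda>i. matrix_inv (Gs i)"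
  let ?Y = "\<lambda>i. (1 / sqrt ?n) *\<^sub>R transpose (R i)"
  obtain V1 :: "real^'d^('n \<times> 'd)" where
    opt: "is_arg_min (\<lambda>W. trace (transpose W ** H_mat E G ** W))
                     (\<lambda>W. transpose W ** W = mat 1) V1"
    and V1: "transpose V1 = block_row (\<lambda>i. transpose (?X i))"
    using assms(1) unfolding algorithm2_output_def by blast
  have "V1 = block_col ?X"
    using V1 by (simp add: vec_eq_iff transpose_def block_row_def block_col_def)
  moreover have "transpose (block_col ?Y) ** block_col ?Y = mat 1"
    using R by (rule block_col_feasible)
  ultimately have "trace (transpose (block_col ?X) ** H_mat E G ** block_col ?X)
      \<le> trace (transpose (block_col ?Y) ** H_mat E G ** block_col ?Y)"
    using opt by (simp add: is_arg_min_linorder)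
  then have "?n * f_cost E G ?X \<le> ?n * f_cost E G ?Y"
    by (simp add: trace_H_mat)
  then show ?thesis
    using f_cost_transpose_orthogonal[OF R, of E G]
    by (simp add: f_cost_scaleR power_divide)
qed

theorem proposition27:
  fixes E :: "('n::finite \<times> 'n) set"
    and G :: "'n \<Rightarrow> 'n \<Rightarrow> real^'d^'d"
    and Gs Gstar :: "'n \<Rightarrow> real^'d^'d"
  assumes "graph_connected E"
    and "\<forall>(i, j)\<in>E. G i j \<in> GL"
    and "algorithm2_output E G Gs"
    and "is_arg_min (g_cost E G) (\<lambda>R. \<forall>i. orthogonal_matrix (R i)) Gstar"
  shows "f_cost E G (\<lambda>i. sqrt (real CARD('n)) *\<^sub>R matrix_inv (Gs i)) \<le> g_cost E G Gstar"
proof (rule f_cost_algorithm2_le[OF assms(3)])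
  show "orthogonal_matrix (Gstar i)" for i
    using assms(4) by (simp add: is_arg_min_def)
qed

end
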